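(* Fix $p\in(0,\infty)$. For every two metric spaces $(X,d_X)$ and $(Y,d_Y)$ we have $$\mathrm{BMW}_p(X)\le 2\,Av_Y^{(2)}(X)\cdot \mathrm{BMW}_p(Y).$$
   Context: All metric spaces are assumed to contain at least two points. Let $\mathbb F_2$ be the field with two elements, $e_1,\ldots,e_n$ the standard basis of $\mathbb F_2^n$, and $e=e_1+\cdots+e_n$. For $p\in(0,\infty)$ and a metric space $(X,d_X)$, $\mathrm{BMW}_p(X)$ is the infimum over those $T\in(0,\infty)$ such that for every $n\in\mathbb N$ every $f:\mathbb F_2^n\to X$ satisfies $$\sum_{x\in\mathbb F_2^n}d_X(f(x),f(x+e))^2\le T^2n^{\frac2p-1}\sum_{i=1}^n\sum_{x\in\mathbb F_2^n}d_X(f(x),f(x+e_i))^2,$$ with $\mathrm{BMW}_p(X)=\infty$ if no such $T$ exists. $Av_Y^{(2)}(X)$ is the infimum over those $D\in[1,\infty]$ such that for every $n\in\mathbb N$ and every $x_1,\ldots,x_n\in X$ that are not all equal there exists a nonconstant Lipschitz function $f:\{x_1,\ldots,x_n\}\to Y$ with $$\left(\frac1{n^2}\sum_{i=1}^n\sum_{j=1}^n d_Y(f(x_i),f(x_j))^2\right)^{1/2}\ge\frac{\|f\|_{\mathrm{Lip}}}{D}\left(\frac1{n^2}\sum_{i=1}^n\sum_{j=1}^n d_X(x_i,x_j)^2\right)^{1/2},$$ where $\|f\|_{\mathrm{Lip}}$ is the Lipschitz constant of $f$. *)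

theory Defs
  imports "HOL-Analysis.Analysis" "HOL-Library.Z2" "HOL-Library.Function_Algebras"
begin

text \<open>
  Vectors of \<open>F_2^n\<close> are functions \<open>nat \<Rightarrow> bit\<close> vanishing outside the coordinates
  \<open>{1..n}\<close>, so that their addition is the pointwise one of \<open>Function_Algebras\<close>.
\<close>

definition F2 :: "nat \<Rightarrow> (nat \<Rightarrow> bit) set" where
  "F2 n = {x. \<forall>j. j \<notin> {1..n} \<longrightarrow> x j = 0}"

definition unit_vec :: "nat \<Rightarrow> nat \<Rightarrow> bit" where
  "unit_vec i = (\<lambda>j. if j = i then 1 else 0)"

definition ones_vec :: "nat \<Rightarrow> nat \<Rightarrow> bit" where
  "ones_vec n = (\<Sum>i=1..n. unit_vec i)"

definition BMW_ineq :: "real \<Rightarrow> 'a metric \<Rightarrow> real \<Rightarrow> bool" where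
  "BMW_ineq p X T \<longleftrightarrow>
     (\<forall>n\<ge>1. \<forall>f \<in> F2 n \<rightarrow> mspace X.
        (\<Sum>x\<in>F2 n. (mdist X (f x) (f (x + ones_vec n)))\<^sup>2)
          \<le> T\<^sup>2 * real n powr (2 / p - 1) *
             (\<Sum>i=1..n. \<Sum>x\<in>F2 n. (mdist X (f x) (f (x + unit_vec i)))\<^sup>2))"

text \<open>The infimum of the empty set is \<open>\<infinity>\<close> in \<^typ>\<open>ennreal\<close>.\<close>

definition BMW :: "real \<Rightarrow> 'a metric \<Rightarrow> ennreal" where
  "BMW p X = Inf {ennreal T | T. 0 < T \<and> BMW_ineq p X T}"

text \<open>
  Meaningful for Lipschitz maps only: for other maps the set below is empty and its real
  infimum is unspecified.
\<close>

definition lip_const :: "'a metric \<Rightarrow> 'b metric \<Rightarrow> ('a \<Rightarrow> 'b) \<Rightarrow> real" where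
  "lip_const X Y f =
     Inf {L. 0 \<le> L \<and> (\<forall>x\<in>mspace X. \<forall>y\<in>mspace X. mdist Y (f x) (f y) \<le> L * mdist X x y)}"

definition avg_dist2 :: "'a metric \<Rightarrow> nat \<Rightarrow> (nat \<Rightarrow> 'a) \<Rightarrow> real" where
  "avg_dist2 X n x = sqrt (1 / (real n)\<^sup>2 * (\<Sum>i=1..n. \<Sum>j=1..n. (mdist X (x i) (x j))\<^sup>2))"

text \<open>
  The points \<open>x 1, \<dots>, x n\<close> need not be distinct; \<open>f\<close> is a map on the set of their values. In
  \<^typ>\<open>ennreal\<close> a finite number divided by \<open>\<infinity>\<close> is \<open>0\<close>, as intended for \<open>D = \<infinity>\<close>.
\<close>

definition Av2_ineq :: "'b metric \<Rightarrow> 'a metric \<Rightarrow> ennreal \<Rightarrow> bool" where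
  "Av2_ineq Y X D \<longleftrightarrow>
     (\<forall>n. \<forall>x \<in> {1..n} \<rightarrow> mspace X. (\<exists>i\<in>{1..n}. \<exists>j\<in>{1..n}. x i \<noteq> x j) \<longrightarrow>
        (\<exists>f. Lipschitz_continuous_map (submetric X (x ` {1..n})) Y f \<and>
             \<not> f constant_on (x ` {1..n}) \<and>
             ennreal (avg_dist2 Y n (\<lambda>i. f (x i)))
               \<ge> ennreal (lip_const (submetric X (x ` {1..n})) Y f) / D
                   * ennreal (avg_dist2 X n x)))"

definition Av2 :: "'b metric \<Rightarrow> 'a metric \<Rightarrow> ennreal" where
  "Av2 Y X = Inf {D. 1 \<le> D \<and> Av2_ineq Y X D}"

end

theory Submission
  imports Defs
begin

text \<open>
  By the triangle inequality through a third point, averaged over that point, the antipodal sum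
  of \<open>f\<close> in \<open>X\<close> is at most four times its average over all pairs. The definition of \<open>Av2\<close> moves
  the average over all pairs to \<open>Y\<close>. There, a uniformly random pair is \<open>(x, x + e_S)\<close> for a
  uniformly random set \<open>S\<close> of coordinates, and the BMW inequality holds on every subcube. By
  symmetry the resulting weights \<open>E (|S| powr (2 / p - 1) 1_{i \<in> S})\<close> do not depend on \<open>i\<close>, so
  each equals \<open>E (|S| powr (2 / p)) / n\<close>, which is at most \<open>n powr (2 / p - 1)\<close> for every \<open>p > 0\<close>.
\<close>

section \<open>Vectors of the cube as sets of coordinates\<close>

definition ind_vec :: "nat set \<Rightarrow> nat \<Rightarrow> bit" where
  "ind_vec S = (\<lambda>j. if j \<in> S then 1 else 0)"

lemma ones_vec_eq: "ones_vec n = ind_vec {1..n}"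
proof -
  have sum_apply: "(\<Sum>i\<in>A. unit_vec i) j = (\<Sum>i\<in>A. unit_vec i j)" if "finite A" for A j
    using that by (induction A) auto
  show ?thesis
    by (rule ext) (simp add: ones_vec_def ind_vec_def sum_apply, simp add: unit_vec_def)
qed

lemma unit_vec_eq: "unit_vec i = ind_vec {i}"
  by (auto simp: unit_vec_def ind_vec_def)

lemma ind_vec_in_F2: "S \<subseteq> {1..n} \<Longrightarrow> ind_vec S \<in> F2 n"
  by (auto simp: F2_def ind_vec_def)

lemma bij_betw_ind_vec: "bij_betw ind_vec (Pow {1..n}) (F2 n)"
proof (rule bij_betw_byWitness[where f' = "\<lambda>x. {j. x j = 1}"])
  show "\<forall>a\<in>Pow {1..n}. {j. ind_vec a j = 1} = a"
    by (auto simp: ind_vec_def)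
  show "\<forall>a'\<in>F2 n. ind_vec {j. a' j = 1} = a'"
    by (auto simp: ind_vec_def fun_eq_iff)
  show "ind_vec ` Pow {1..n} \<subseteq> F2 n"
    using ind_vec_in_F2 by auto
  show "(\<lambda>x. {j. x j = 1}) ` F2 n \<subseteq> Pow {1..n}"
    by (force simp: F2_def)
qed

lemma finite_F2: "finite (F2 n)"
  using bij_betw_finite[OF bij_betw_ind_vec[of n]] by simp

lemma card_F2: "card (F2 n) = 2 ^ n"
  using bij_betw_same_card[OF bij_betw_ind_vec[of n]] by (simp add: card_Pow)

lemma F2_add: "x \<in> F2 n \<Longrightarrow> y \<in> F2 n \<Longrightarrow> x + y \<in> F2 n"
  by (auto simp: F2_def)

lemma bit_fun_add_self: "x + x = (0 :: nat \<Rightarrow> bit)"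
  by (auto simp: fun_eq_iff)

text \<open>In characteristic 2 a translation is its own inverse.\<close>

lemma bij_betw_F2_add:
  assumes "v \<in> F2 n"
  shows "bij_betw (\<lambda>x. x + v) (F2 n) (F2 n)"
  by (rule bij_betw_byWitness[where f' = "\<lambda>x. x + v"])
     (use assms in \<open>auto simp: F2_add add.assoc bit_fun_add_self\<close>)

lemma sum_F2_add:
  assumes "v \<in> F2 n"
  shows "(\<Sum>x\<in>F2 n. g (x + v)) = (\<Sum>x\<in>F2 n. g x)"
  using sum.reindex_bij_betw[OF bij_betw_F2_add[OF assms]] .

section \<open>Edge sums, pair sums and antipodal sums on the cube\<close>

lemma mdist_self: "x \<in> mspace X \<Longrightarrow> mdist X x x = 0"
  by simp

text \<open>The subcube in the directions of \<open>S\<close> is a cube of dimension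
  \<open>card S\<close>, so the inequality applies there with that dimension in the power. Summing
  over all base points recovers full sums, since translations permute \<open>F2 n\<close>. A
  nonempty \<open>S\<close> provides the dimension at least 1 that \<open>BMW_ineq\<close> asks
  for.\<close>

lemma BMW_ineq_subcube:
  assumes T: "BMW_ineq p Y T" and h: "h \<in> F2 n \<rightarrow> mspace Y"
    and S: "S \<subseteq> {1..n}" "S \<noteq> {}"
  shows "(\<Sum>x\<in>F2 n. (mdist Y (h x) (h (x + ind_vec S)))\<^sup>2)
          \<le> T\<^sup>2 * real (card S) powr (2 / p - 1) *
             (\<Sum>i\<in>S. \<Sum>x\<in>F2 n. (mdist Y (h x) (h (x + unit_vec i)))\<^sup>2)"
proof -
  define k where "k = card S"
  have fin: "finite S" using S finite_subset by blast
  have k: "k \<ge> 1" using S fin by (simp add: k_def card_gt_0_iff Suc_le_eq)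
  obtain s where s: "bij_betw s {1..k} S"
    using fin ex_bij_betw_nat_finite_1 k_def by blast
  define t where "t = inv_into {1..k} s"
  have t_in: "t j \<in> {1..k}" if "j \<in> S" for j
    using that s unfolding t_def by (metis bij_betw_def inv_into_into)
  have s_t: "s (t j) = j" if "j \<in> S" for j
    using that s unfolding t_def by (metis bij_betw_def f_inv_into_f)
  have t_s: "t (s i) = i" if "i \<in> {1..k}" for i
    using that s unfolding t_def by (metis bij_betw_def inv_into_f_f)
  have s_in: "s i \<in> S" if "i \<in> {1..k}" for i
    using that s by (metis bij_betwE)
  \<comment> \<open>On \<open>F2 k\<close> this is the additive injection onto the vectors supported
    in \<open>S\<close>, so it carries cube edges and diagonals to those of the subcube.\<close>
  define emb where "emb z = (\<lambda>j. if j \<in> S then z (t j) else 0)" for z :: "nat \<Rightarrow> bit"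
  have emb_F2: "emb z \<in> F2 n" for z
    using S by (auto simp: emb_def F2_def)
  have emb_add: "emb (z + w) = emb z + emb w" for z w
    by (auto simp: emb_def fun_eq_iff)
  have emb_ones: "emb (ones_vec k) = ind_vec S"
    unfolding ones_vec_eq using t_in by (auto simp: emb_def ind_vec_def fun_eq_iff)
  have emb_unit: "emb (unit_vec i) = unit_vec (s i)" if "i \<in> {1..k}" for i
    using that s_t t_s s_in by (auto simp: emb_def unit_vec_def fun_eq_iff)
  have u: "unit_vec i \<in> F2 n" if "i \<in> S" for i
    using that S by (auto simp: unit_vec_eq intro!: ind_vec_in_F2)
  define A where "A v = (\<Sum>x\<in>F2 n. (mdist Y (h x) (h (x + v)))\<^sup>2)" for v
  have shift: "(\<Sum>x\<in>F2 n. (mdist Y (h (x + emb z)) (h (x + emb z + v)))\<^sup>2) = A v" for z v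
    unfolding A_def by (rule sum_F2_add[OF emb_F2])
  \<comment> \<open>The subcube through every point \<open>x\<close> is used, so each of its edges is counted \<open>2 ^ k\<close> times.\<close>
  have line: "(\<Sum>z\<in>F2 k. (mdist Y (h (x + emb z)) (h (x + emb z + ind_vec S)))\<^sup>2)
          \<le> T\<^sup>2 * real k powr (2 / p - 1) *
             (\<Sum>i=1..k. \<Sum>z\<in>F2 k. (mdist Y (h (x + emb z)) (h (x + emb z + unit_vec (s i))))\<^sup>2)"
    if x: "x \<in> F2 n" for x
  proof -
    have "(\<lambda>z. h (x + emb z)) \<in> F2 k \<rightarrow> mspace Y"
      using h F2_add[OF x emb_F2] by auto
    from T[unfolded BMW_ineq_def, rule_format, OF k this]
    have "(\<Sum>z\<in>F2 k. (mdist Y (h (x + emb z)) (h (x + emb (z + ones_vec k))))\<^sup>2)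
          \<le> T\<^sup>2 * real k powr (2 / p - 1) *
             (\<Sum>i=1..k. \<Sum>z\<in>F2 k. (mdist Y (h (x + emb z)) (h (x + emb (z + unit_vec i))))\<^sup>2)"
      .
    then show ?thesis
      by (simp add: emb_add emb_ones emb_unit add.assoc del: plus_fun_apply)
  qed
  \<comment> \<open>Once the sums are exchanged, \<open>shift\<close> makes the sum over
    \<open>x\<close> independent of \<open>z\<close>; both sides then carry the factor
    \<open>2 ^ k\<close>, which cancels.\<close>
  have "2 ^ k * A (ind_vec S) =
      (\<Sum>x\<in>F2 n. \<Sum>z\<in>F2 k. (mdist Y (h (x + emb z)) (h (x + emb z + ind_vec S)))\<^sup>2)"
    by (subst sum.swap) (simp add: shift card_F2)
  also have "\<dots> \<le> (\<Sum>x\<in>F2 n. T\<^sup>2 * real k powr (2 / p - 1) *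
      (\<Sum>i=1..k. \<Sum>z\<in>F2 k. (mdist Y (h (x + emb z)) (h (x + emb z + unit_vec (s i))))\<^sup>2))"
    by (intro sum_mono line)
  also have "\<dots> = T\<^sup>2 * real k powr (2 / p - 1) *
      (\<Sum>i=1..k. \<Sum>z\<in>F2 k. \<Sum>x\<in>F2 n. (mdist Y (h (x + emb z)) (h (x + emb z + unit_vec (s i))))\<^sup>2)"
    by (subst sum.swap[of _ "F2 n" "F2 k"], subst sum.swap[of _ "F2 n" "{1..k}"])
       (simp flip: sum_distrib_left)
  also have "\<dots> = 2 ^ k * (T\<^sup>2 * real k powr (2 / p - 1) * (\<Sum>i=1..k. A (unit_vec (s i))))"
    by (simp add: shift card_F2 flip: sum_distrib_left)
  also have "(\<Sum>i=1..k. A (unit_vec (s i))) = (\<Sum>i\<in>S. A (unit_vec i))"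
    by (rule sum.reindex_bij_betw[OF s])
  finally show ?thesis
    by (simp add: A_def k_def)
qed

text \<open>The transposition of \<open>i\<close> and \<open>j\<close> permutes the subsets of
  \<open>A\<close>, preserves cardinality and exchanges membership of \<open>i\<close> with
  membership of \<open>j\<close>.\<close>

lemma sum_subsets_containing_eq:
  fixes w :: "nat \<Rightarrow> real"
  assumes "i \<in> A" "j \<in> A"
  shows "(\<Sum>S | S \<subseteq> A \<and> i \<in> S. w (card S)) = (\<Sum>S | S \<subseteq> A \<and> j \<in> S. w (card S))"
proof (rule sum.reindex_bij_witness[where i = "image (Transposition.transpose i j)"
        and j = "image (Transposition.transpose i j)"])
  show "Transposition.transpose i j ` S \<in> {S. S \<subseteq> A \<and> j \<in> S}"
    if "S \<in> {S. S \<subseteq> A \<and> i \<in> S}" for S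
    using that assms by (force simp: Transposition.transpose_def)
  show "Transposition.transpose i j ` S \<in> {S. S \<subseteq> A \<and> i \<in> S}"
    if "S \<in> {S. S \<subseteq> A \<and> j \<in> S}" for S
    using that assms by (force simp: Transposition.transpose_def)
  show "w (card (Transposition.transpose i j ` S)) = w (card S)" for S
    by (simp add: card_image)
qed (auto simp: image_image)

text \<open>Double counting of the pairs \<open>j \<in> S\<close> raises the exponent to
  \<open>2 / p\<close>. Only then is \<open>card S\<close> replaced by \<open>n\<close>:
  \<open>2 / p\<close> is positive, whereas \<open>2 / p - 1\<close> is negative for
  \<open>p > 2\<close>.\<close>

lemma sum_card_powr_containing_le:
  assumes p: "0 < p" and i: "i \<in> {1..n}"
  shows "(\<Sum>S | S \<subseteq> {1..n} \<and> i \<in> S. real (card S) powr (2 / p - 1))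
    \<le> 2 ^ n * real n powr (2 / p - 1)"
proof -
  let ?c = "\<lambda>i. \<Sum>S | S \<subseteq> {1..n} \<and> i \<in> S. real (card S) powr (2 / p - 1)"
  have n: "0 < n" using i by simp
  \<comment> \<open>The case \<open>k = 0\<close>, which the empty set produces, holds because
    \<open>0 powr a = 0\<close>.\<close>
  have powr_base: "real k * real k powr (2 / p - 1) = real k powr (2 / p)" for k
    using powr_mult_base[of "real k" "2 / p - 1"] by simp
  have "real n * ?c i = (\<Sum>j=1..n. ?c j)"
  proof -
    have "?c j = ?c i" if "j \<in> {1..n}" for j
      by (rule sum_subsets_containing_eq[OF that i])
    then have "(\<Sum>j=1..n. ?c j) = (\<Sum>j=1..n. ?c i)"
      by (rule sum.cong[OF refl])
    then show ?thesis by simp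
  qed
  also have "\<dots> = (\<Sum>S\<in>Pow {1..n}. \<Sum>j | j \<in> {1..n} \<and> j \<in> S. real (card S) powr (2 / p - 1))"
    using sum.swap_restrict[of "{1..n}" "Pow {1..n}" "\<lambda>j S. real (card S) powr (2 / p - 1)"
        "\<lambda>j S. j \<in> S"] by simp
  also have "\<dots> = (\<Sum>S\<in>Pow {1..n}. real (card S) powr (2 / p))"
  proof (rule sum.cong)
    fix S assume "S \<in> Pow {1..n}"
    then have "{j. j \<in> {1..n} \<and> j \<in> S} = S" by auto
    then show "(\<Sum>j | j \<in> {1..n} \<and> j \<in> S. real (card S) powr (2 / p - 1)) = real (card S) powr (2 / p)"
      by (simp add: powr_base)
  qed simp
  also have "\<dots> \<le> (\<Sum>S\<in>Pow {1..n}. real n powr (2 / p))"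
  proof (rule sum_mono)
    fix S assume "S \<in> Pow {1..n}"
    then have "card S \<le> n" using card_mono[of "{1..n}" S] by simp
    then show "real (card S) powr (2 / p) \<le> real n powr (2 / p)"
      using p by (intro powr_mono2) auto
  qed
  also have "\<dots> = real n * (2 ^ n * real n powr (2 / p - 1))"
    by (simp add: card_Pow flip: powr_base)
  finally show ?thesis
    using n by simp
qed

lemma BMW_ineq_all_pairs:
  assumes p: "0 < p" and T: "BMW_ineq p Y T" and h: "h \<in> F2 n \<rightarrow> mspace Y"
  shows "(\<Sum>x\<in>F2 n. \<Sum>y\<in>F2 n. (mdist Y (h x) (h y))\<^sup>2)
          \<le> 2 ^ n * (T\<^sup>2 * real n powr (2 / p - 1) *
             (\<Sum>i=1..n. \<Sum>x\<in>F2 n. (mdist Y (h x) (h (x + unit_vec i)))\<^sup>2))"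
proof -
  define A where "A v = (\<Sum>x\<in>F2 n. (mdist Y (h x) (h (x + v)))\<^sup>2)" for v
  have A0: "A v \<ge> 0" for v
    by (simp add: A_def sum_nonneg)
  have "(\<Sum>x\<in>F2 n. \<Sum>y\<in>F2 n. (mdist Y (h x) (h y))\<^sup>2)
      = (\<Sum>x\<in>F2 n. \<Sum>y\<in>F2 n. (mdist Y (h x) (h (x + y)))\<^sup>2)"
  \<comment> \<open>For fixed \<open>x\<close> the second point is parametrized by its displacement
    from \<open>x\<close>.\<close>
  proof (rule sum.cong)
    fix x assume "x \<in> F2 n"
    then show "(\<Sum>y\<in>F2 n. (mdist Y (h x) (h y))\<^sup>2) = (\<Sum>y\<in>F2 n. (mdist Y (h x) (h (x + y)))\<^sup>2)"
      using sum_F2_add[of x n "\<lambda>y. (mdist Y (h x) (h y))\<^sup>2"] by (simp add: add.commute)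
  qed simp
  also have "\<dots> = (\<Sum>v\<in>F2 n. A v)"
    unfolding A_def by (rule sum.swap)
  also have "\<dots> = (\<Sum>S\<in>Pow {1..n}. A (ind_vec S))"
    using sum.reindex_bij_betw[OF bij_betw_ind_vec, of A n] by simp
  also have "\<dots> \<le> (\<Sum>S\<in>Pow {1..n}. \<Sum>i | i \<in> {1..n} \<and> i \<in> S.
      T\<^sup>2 * real (card S) powr (2 / p - 1) * A (unit_vec i))"
  proof (rule sum_mono)
    fix S assume S: "S \<in> Pow {1..n}"
    then have eq: "{i. i \<in> {1..n} \<and> i \<in> S} = S" by auto
    show "A (ind_vec S) \<le> (\<Sum>i | i \<in> {1..n} \<and> i \<in> S.
      T\<^sup>2 * real (card S) powr (2 / p - 1) * A (unit_vec i))"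
    proof (cases "S = {}")
      case True
      \<comment> \<open>No subcube inequality is available for the empty set, but its displacement
        is zero and contributes nothing.\<close>
      have "ind_vec {} = 0" by (auto simp: ind_vec_def)
      then have "A (ind_vec S) = 0"
        using h by (simp add: A_def True mdist_self Pi_iff)
      then show ?thesis by (simp add: True)
    next
      case False
      then show ?thesis
        using BMW_ineq_subcube[OF T h _ False] S
        unfolding eq A_def by (simp add: sum_distrib_left)
    qed
  qed
  \<comment> \<open>Regrouping by direction: the edge sum of direction \<open>i\<close> collects the
    weights of all \<open>S\<close> containing \<open>i\<close>.\<close>
  also have "\<dots> = (\<Sum>i=1..n. \<Sum>S | S \<in> Pow {1..n} \<and> i \<in> S.
      T\<^sup>2 * real (card S) powr (2 / p - 1) * A (unit_vec i))"
    by (rule sum.swap_restrict) auto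
  also have "\<dots> = (\<Sum>i=1..n. T\<^sup>2 * A (unit_vec i) *
      (\<Sum>S | S \<subseteq> {1..n} \<and> i \<in> S. real (card S) powr (2 / p - 1)))"
    by (simp add: sum_distrib_left mult_ac)
  also have "\<dots> \<le> (\<Sum>i=1..n. T\<^sup>2 * A (unit_vec i) * (2 ^ n * real n powr (2 / p - 1)))"
    using A0 by (intro sum_mono mult_left_mono sum_card_powr_containing_le p) auto
  also have "\<dots> = 2 ^ n * (T\<^sup>2 * real n powr (2 / p - 1) * (\<Sum>i=1..n. A (unit_vec i)))"
    by (simp add: sum_distrib_left sum_distrib_right mult_ac)
  finally show ?thesis by (simp add: A_def)
qed

text \<open>Each distance is split through every \<open>y\<close>, whence the factor
  \<open>2 ^ n\<close>. Squaring costs a factor 2, and the two resulting pair sums agree by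
  translation invariance, so the constant is 4.\<close>

lemma sum_antipodal_le_sum_pairs:
  assumes f: "f \<in> F2 n \<rightarrow> mspace X" and v: "v \<in> F2 n"
  shows "2 ^ n * (\<Sum>x\<in>F2 n. (mdist X (f x) (f (x + v)))\<^sup>2)
    \<le> 4 * (\<Sum>x\<in>F2 n. \<Sum>y\<in>F2 n. (mdist X (f x) (f y))\<^sup>2)"
proof -
  let ?P = "\<Sum>x\<in>F2 n. \<Sum>y\<in>F2 n. (mdist X (f x) (f y))\<^sup>2"
  have "2 ^ n * (\<Sum>x\<in>F2 n. (mdist X (f x) (f (x + v)))\<^sup>2)
      = (\<Sum>x\<in>F2 n. \<Sum>y\<in>F2 n. (mdist X (f x) (f (x + v)))\<^sup>2)"
    by (simp add: card_F2 sum_distrib_left)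
  also have "\<dots> \<le> (\<Sum>x\<in>F2 n. \<Sum>y\<in>F2 n.
      2 * (mdist X (f x) (f y))\<^sup>2 + 2 * (mdist X (f (x + v)) (f y))\<^sup>2)"
  proof (intro sum_mono)
    fix x y assume xy: "x \<in> F2 n" "y \<in> F2 n"
    let ?a = "mdist X (f x) (f y)" and ?b = "mdist X (f (x + v)) (f y)"
    have "mdist X (f x) (f (x + v)) \<le> ?a + ?b"
      using f xy F2_add[OF xy(1) v] by (metis PiE mdist_commute mdist_triangle)
    then have "(mdist X (f x) (f (x + v)))\<^sup>2 \<le> (?a + ?b)\<^sup>2"
      by (intro power_mono) auto
    also have "\<dots> \<le> 2 * ?a\<^sup>2 + 2 * ?b\<^sup>2"
      \<comment> \<open>The difference of the two sides is \<open>(?a - ?b)\<^sup>2\<close>.\<close>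
      using zero_le_power2[of "?a - ?b"] by (simp add: power2_eq_square algebra_simps)
    finally show "(mdist X (f x) (f (x + v)))\<^sup>2 \<le> 2 * ?a\<^sup>2 + 2 * ?b\<^sup>2" .
  qed
  also have "\<dots> = 2 * ?P + 2 * (\<Sum>x\<in>F2 n. \<Sum>y\<in>F2 n. (mdist X (f (x + v)) (f y))\<^sup>2)"
    by (simp add: sum.distrib sum_distrib_left)
  also have "(\<Sum>x\<in>F2 n. \<Sum>y\<in>F2 n. (mdist X (f (x + v)) (f y))\<^sup>2) = ?P"
    by (rule sum_F2_add[OF v])
  finally show ?thesis by linarith
qed

section \<open>Lipschitz maps from \<open>X\<close> to \<open>Y\<close> and transfer of the
  inequality\<close>

lemma lip_const_bound:
  assumes g: "Lipschitz_continuous_map X Y g" and xy: "x \<in> mspace X" "y \<in> mspace X"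
  shows "mdist Y (g x) (g y) \<le> lip_const X Y g * mdist X x y"
proof (cases "x = y")
  case True
  then show ?thesis
    using g xy by (auto simp: Lipschitz_continuous_map_def Pi_iff mdist_self)
next
  case False
  then have pos: "0 < mdist X x y"
    using xy by (simp add: order_less_le)
  obtain B where B: "B > 0" "\<forall>x\<in>mspace X. \<forall>y\<in>mspace X. mdist Y (g x) (g y) \<le> B * mdist X x y"
    using g unfolding Lipschitz_continuous_map_pos by blast
  \<comment> \<open>The ratio is a lower bound of the admissible constants, and there is one because
    \<open>g\<close> is Lipschitz; hence the infimum is itself admissible.\<close>
  have "mdist Y (g x) (g y) / mdist X x y \<le> lip_const X Y g"
    unfolding lip_const_def
  proof (rule cInf_greatest)
    show "{L. 0 \<le> L \<and> (\<forall>x\<in>mspace X. \<forall>y\<in>mspace X. mdist Y (g x) (g y) \<le> L * mdist X x y)} \<noteq> {}"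
      using B by (auto intro!: exI[of _ B])
  qed (use xy pos in \<open>auto simp: divide_simps\<close>)
  then show ?thesis
    using pos by (simp add: divide_simps)
qed

lemma avg_dist2_enum:
  assumes b: "bij_betw b {1..N} F"
  shows "avg_dist2 X N (\<lambda>i. f (b i)) = sqrt (\<Sum>x\<in>F. \<Sum>y\<in>F. (mdist X (f x) (f y))\<^sup>2) / real N"
proof -
  have "(\<Sum>i=1..N. \<Sum>j=1..N. (mdist X (f (b i)) (f (b j)))\<^sup>2)
      = (\<Sum>x\<in>F. \<Sum>y\<in>F. (mdist X (f x) (f y))\<^sup>2)"
    using sum.reindex_bij_betw[OF b, of "\<lambda>x. \<Sum>y\<in>F. (mdist X (f x) (f y))\<^sup>2"]
    by (simp only: sum.reindex_bij_betw[OF b, of "\<lambda>y. (mdist X (f _) (f y))\<^sup>2"])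
  then show ?thesis
    by (simp add: avg_dist2_def real_sqrt_divide)
qed

text \<open>The list of points is \<open>f\<close> along an enumeration of \<open>F\<close>, so
  values are repeated according to their fibres and the averages become pair sums over
  \<open>F\<close>. The conclusion is free of roots, normalization and extended reals;
  \<open>0 < L\<close> allows later cancellation.\<close>

lemma Av2_ineq_map:
  assumes D: "1 \<le> D" "Av2_ineq Y X (ennreal D)" and F: "finite F"
    and f: "f \<in> F \<rightarrow> mspace X" and nc: "\<not> f constant_on F"
  obtains g L where "g \<in> f ` F \<rightarrow> mspace Y" "0 < L"
    "\<And>x y. x \<in> F \<Longrightarrow> y \<in> F \<Longrightarrow> mdist Y (g (f x)) (g (f y)) \<le> L * mdist X (f x) (f y)"
    "L\<^sup>2 * (\<Sum>x\<in>F. \<Sum>y\<in>F. (mdist X (f x) (f y))\<^sup>2)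
      \<le> D\<^sup>2 * (\<Sum>x\<in>F. \<Sum>y\<in>F. (mdist Y (g (f x)) (g (f y)))\<^sup>2)"
proof -
  define N where "N = card F"
  obtain b where b: "bij_betw b {1..N} F"
    using F ex_bij_betw_nat_finite_1 N_def by blast
  have F0: "F \<noteq> {}"
    using nc by (auto simp: constant_on_def)
  then have N: "N > 0"
    using F by (simp add: N_def card_gt_0_iff)
  have bF: "b ` {1..N} = F"
    using b by (simp add: bij_betw_def)
  define x where "x = (\<lambda>i. f (b i))"
  have x_im: "x ` {1..N} = f ` F"
    unfolding bF[symmetric] by (auto simp: x_def)
  have x_in: "x \<in> {1..N} \<rightarrow> mspace X"
    using f bF by (auto simp: x_def)
  have "\<exists>i\<in>{1..N}. \<exists>j\<in>{1..N}. x i \<noteq> x j"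
  proof (rule ccontr)
    assume "\<not> ?thesis"
    then have "\<forall>u\<in>F. \<forall>v\<in>F. f u = f v"
      unfolding bF[symmetric] x_def by blast
    with nc F0 show False
      by (metis constant_on_def)
  qed
  with D(2) x_in obtain g where
    g: "Lipschitz_continuous_map (submetric X (f ` F)) Y g"
    "\<not> g constant_on (f ` F)"
    "ennreal (avg_dist2 Y N (\<lambda>i. g (x i)))
       \<ge> ennreal (lip_const (submetric X (f ` F)) Y g) / ennreal D * ennreal (avg_dist2 X N x)"
    unfolding Av2_ineq_def x_im[symmetric] by blast
  define Z where "Z = submetric X (f ` F)"
  define L where "L = lip_const Z Y g"
  have fF: "f ` F \<subseteq> mspace X"
    using f by auto
  then have Z: "mspace Z = f ` F" "mdist Z = mdist X"
    by (auto simp: Z_def)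
  have lip: "Lipschitz_continuous_map Z Y g"
    using g(1) by (simp add: Z_def)
  then have gY: "g \<in> f ` F \<rightarrow> mspace Y"
    by (auto simp: Lipschitz_continuous_map_def Z)
  have bound: "mdist Y (g u) (g v) \<le> L * mdist X u v" if "u \<in> f ` F" "v \<in> f ` F" for u v
    using lip_const_bound[OF lip, of u v] that by (simp add: Z L_def)
  \<comment> \<open>Two distinct values of \<open>g\<close> make the left side of
    \<open>bound\<close> positive, which forces \<open>L\<close> to be positive.\<close>
  obtain v where v: "v \<in> f ` F"
    using F0 by blast
  then obtain u where uv: "u \<in> f ` F" "v \<in> f ` F" "g u \<noteq> g v"
    using g(2) unfolding constant_on_def by blast
  moreover have "g u \<in> mspace Y" "g v \<in> mspace Y"
    using uv gY by blast+
  ultimately have "0 < mdist Y (g u) (g v)"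
    by (simp add: order_less_le)
  then have "0 < L * mdist X u v"
    using bound[OF uv(1,2)] by linarith
  then have L: "0 < L"
    using mdist_nonneg[of X u v] by (simp add: zero_less_mult_iff)
  let ?PX = "\<Sum>x\<in>F. \<Sum>y\<in>F. (mdist X (f x) (f y))\<^sup>2"
  let ?PY = "\<Sum>x\<in>F. \<Sum>y\<in>F. (mdist Y (g (f x)) (g (f y)))\<^sup>2"
  have P0: "?PX \<ge> 0" "?PY \<ge> 0"
    by (auto intro!: sum_nonneg)
  have "ennreal L / ennreal D * ennreal (sqrt ?PX / N) \<le> ennreal (sqrt ?PY / N)"
    using g(3) avg_dist2_enum[OF b, of X f] avg_dist2_enum[OF b, of Y "\<lambda>x. g (f x)"]
    by (simp add: x_def L_def Z_def)
  \<comment> \<open>With \<open>D\<close> real and at least 1, the extended division is the real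
    one.\<close>
  then have "ennreal (L / D * (sqrt ?PX / N)) \<le> ennreal (sqrt ?PY / N)"
    using L D(1) P0
    by (simp add: divide_ennreal flip: ennreal_mult
        del: times_divide_eq_right times_divide_eq_left times_divide_times_eq)
  then have "L / D * (sqrt ?PX / N) \<le> sqrt ?PY / N"
    using P0 by (simp add: ennreal_le_iff)
  then have "L * sqrt ?PX \<le> D * sqrt ?PY"
    using N D(1) by (simp add: field_simps)
  then have "(L * sqrt ?PX)\<^sup>2 \<le> (D * sqrt ?PY)\<^sup>2"
    using L P0 by (intro power_mono) auto
  then have "L\<^sup>2 * ?PX \<le> D\<^sup>2 * ?PY"
    using P0 by (simp add: power_mult_distrib)
  with that gY L bound show thesis
    by blast
qed

text \<open>The average comparison and the Lipschitz bound on edges each bring a factor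
  \<open>L\<^sup>2\<close>, so the scale of the map into \<open>Y\<close> cancels. The 2 in the
  constant is the square root of the 4 from the triangle inequality.\<close>

lemma BMW_ineq_transfer:
  assumes p: "0 < p" and D: "1 \<le> D" "Av2_ineq Y X (ennreal D)" and T: "BMW_ineq p Y T"
  shows "BMW_ineq p X (2 * D * T)"
  unfolding BMW_ineq_def
proof (intro allI impI ballI)
  fix n :: nat and f assume n: "1 \<le> n" and f: "f \<in> F2 n \<rightarrow> mspace X"
  define a where "a = T\<^sup>2 * real n powr (2 / p - 1)"
  have a0: "a \<ge> 0" by (simp add: a_def)
  let ?A = "\<Sum>x\<in>F2 n. (mdist X (f x) (f (x + ones_vec n)))\<^sup>2"
  let ?E = "\<Sum>i=1..n. \<Sum>x\<in>F2 n. (mdist X (f x) (f (x + unit_vec i)))\<^sup>2"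
  let ?P = "\<Sum>x\<in>F2 n. \<Sum>y\<in>F2 n. (mdist X (f x) (f y))\<^sup>2"
  have ones: "ones_vec n \<in> F2 n"
    by (simp add: ones_vec_eq ind_vec_in_F2)
  have units: "unit_vec i \<in> F2 n" if "i \<in> {1..n}" for i
    using that by (simp add: unit_vec_eq ind_vec_in_F2)
  have P: "?P \<le> 2 ^ n * (D\<^sup>2 * a * ?E)"
  \<comment> \<open>\<open>Av2_ineq\<close> speaks only of points that are not all equal, so
    constant \<open>f\<close> is treated apart.\<close>
  proof (cases "f constant_on F2 n")
    case True
    then have "?P = 0"
      using f by (auto simp: constant_on_def Pi_iff mdist_self intro!: sum.neutral)
    then show ?thesis
      using a0 by (auto intro!: mult_nonneg_nonneg sum_nonneg)
  next
    case False
    then obtain g L where g: "g \<in> f ` F2 n \<rightarrow> mspace Y" and L: "0 < L"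
      and lip: "\<And>x y. x \<in> F2 n \<Longrightarrow> y \<in> F2 n \<Longrightarrow>
        mdist Y (g (f x)) (g (f y)) \<le> L * mdist X (f x) (f y)"
      and le: "L\<^sup>2 * ?P \<le> D\<^sup>2 * (\<Sum>x\<in>F2 n. \<Sum>y\<in>F2 n. (mdist Y (g (f x)) (g (f y)))\<^sup>2)"
      using Av2_ineq_map[OF D finite_F2 f] by metis
    let ?EY = "\<Sum>i=1..n. \<Sum>x\<in>F2 n. (mdist Y (g (f x)) (g (f (x + unit_vec i))))\<^sup>2"
    have "(\<lambda>x. g (f x)) \<in> F2 n \<rightarrow> mspace Y"
      using g by auto
    from BMW_ineq_all_pairs[OF p T this]
    have pairs: "(\<Sum>x\<in>F2 n. \<Sum>y\<in>F2 n. (mdist Y (g (f x)) (g (f y)))\<^sup>2) \<le> 2 ^ n * (a * ?EY)"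
      by (simp add: a_def)
    \<comment> \<open>The Lipschitz bound is applied along the edges of the cube only.\<close>
    have "?EY \<le> (\<Sum>i=1..n. \<Sum>x\<in>F2 n. (L * mdist X (f x) (f (x + unit_vec i)))\<^sup>2)"
      by (intro sum_mono power_mono lip F2_add units) auto
    also have "\<dots> = L\<^sup>2 * ?E"
      by (simp add: power_mult_distrib sum_distrib_left)
    finally have EY: "?EY \<le> L\<^sup>2 * ?E" .
    note le
    also have "D\<^sup>2 * (\<Sum>x\<in>F2 n. \<Sum>y\<in>F2 n. (mdist Y (g (f x)) (g (f y)))\<^sup>2)
        \<le> D\<^sup>2 * (2 ^ n * (a * ?EY))"
      using pairs by (intro mult_left_mono) auto
    also have "\<dots> \<le> D\<^sup>2 * (2 ^ n * (a * (L\<^sup>2 * ?E)))"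
      using EY a0 by (intro mult_left_mono) auto
    also have "\<dots> = L\<^sup>2 * (2 ^ n * (D\<^sup>2 * a * ?E))"
      by (simp add: mult_ac)
    finally show ?thesis
      using L by simp
  qed
  have "2 ^ n * ?A \<le> 4 * ?P"
    by (rule sum_antipodal_le_sum_pairs[OF f ones])
  also have "\<dots> \<le> 2 ^ n * (4 * D\<^sup>2 * a * ?E)"
    using P by simp
  finally have "?A \<le> 4 * D\<^sup>2 * a * ?E"
    by simp
  then show "?A \<le> (2 * D * T)\<^sup>2 * real n powr (2 / p - 1) * ?E"
    by (simp add: a_def power_mult_distrib mult_ac)
qed

section \<open>Lower bounds and infima in \<open>ennreal\<close>\<close>

lemma BMW_ineq_ge_1:
  assumes Y: "y \<in> mspace Y" "z \<in> mspace Y" "y \<noteq> z" and T: "0 < T" "BMW_ineq p Y T"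
  shows "1 \<le> T"
proof -
  \<comment> \<open>In dimension 1 the antipode of a point is its only neighbour and the power of
    \<open>n\<close> is 1. A map taking both values \<open>y\<close> and \<open>z\<close> thus gives
    equal positive sums on the two sides.\<close>
  define h where "h = (\<lambda>x :: nat \<Rightarrow> bit. if x 1 = 0 then y else z)"
  have "h \<in> F2 1 \<rightarrow> mspace Y"
    using Y by (auto simp: h_def)
  then have le: "(\<Sum>x\<in>F2 1. (mdist Y (h x) (h (x + ones_vec 1)))\<^sup>2)
          \<le> T\<^sup>2 * real 1 powr (2 / p - 1) *
             (\<Sum>i=1..1. \<Sum>x\<in>F2 1. (mdist Y (h x) (h (x + unit_vec i)))\<^sup>2)"
    using T(2) unfolding BMW_ineq_def by blast
  have d: "0 < mdist Y y z"
    using Y by (simp add: order_less_le)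
  have swap_dist: "mdist Y (h x) (h (x + unit_vec 1)) = mdist Y y z" for x
    by (cases "x 1") (auto simp: h_def unit_vec_def mdist_commute)
  have "ones_vec 1 = unit_vec 1"
    by (simp add: ones_vec_def)
  then have "2 * (mdist Y y z)\<^sup>2 \<le> T\<^sup>2 * (2 * (mdist Y y z)\<^sup>2)"
    using le swap_dist card_F2[of 1] by simp
  then have "1 \<le> T\<^sup>2"
    using d by simp
  then show ?thesis
    using T(1) by (simp add: power2_nonneg_ge_1_iff)
qed

text \<open>This excludes the product of 0 and \<open>\<infinity>\<close>, which is 0 in
  \<open>ennreal\<close>, when \<open>Av2 Y X\<close> is infinite.\<close>

lemma BMW_ge_1:
  assumes "\<exists>x\<in>mspace Y. \<exists>y\<in>mspace Y. x \<noteq> y"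
  shows "1 \<le> BMW p Y"
  unfolding BMW_def using assms BMW_ineq_ge_1 by (auto intro!: Inf_greatest)

text \<open>Division by \<open>b\<close> moves the bound under the infimum. Nonzero factors exclude
  the product of 0 and \<open>\<infinity>\<close>: for empty \<open>A\<close> the infimum is
  \<open>\<infinity>\<close>, so \<open>b = 0\<close> would make the bound fail for positive
  \<open>c\<close>.\<close>

lemma le_Inf_mult_ennreal:
  fixes A :: "ennreal set"
  assumes A: "Inf A \<noteq> 0" and b: "b \<noteq> 0" and le: "\<And>a. a \<in> A \<Longrightarrow> c \<le> a * b"
  shows "c \<le> Inf A * b"
proof (cases "b = top")
  case True
  then show ?thesis using A by (simp add: ennreal_mult_top)
next
  case False
  have "c / b \<le> Inf A"
    using b le by (intro Inf_greatest divide_le_posI_ennreal)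
      (auto simp: mult.commute zero_less_iff_neq_zero)
  then have "c / b * b \<le> Inf A * b"
    by (rule mult_right_mono) simp
  moreover have "c / b * b = c"
    using b False
    by (metis ennreal_times_divide mult.commute mult_divide_eq_ennreal)
  ultimately show ?thesis by simp
qed

theorem lemma1p13:
  fixes p :: real and X :: "'a metric" and Y :: "'b metric"
  assumes "0 < p"
    and "\<exists>x\<in>mspace X. \<exists>y\<in>mspace X. x \<noteq> y"
    and "\<exists>x\<in>mspace Y. \<exists>y\<in>mspace Y. x \<noteq> y"
  shows "BMW p X \<le> 2 * Av2 Y X * BMW p Y"
proof -
  let ?A = "{D. 1 \<le> D \<and> Av2_ineq Y X D}"
  let ?B = "{ennreal T | T. 0 < T \<and> BMW_ineq p Y T}"
  have A: "1 \<le> Inf ?A"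
    by (auto intro: Inf_greatest)
  have B: "1 \<le> Inf ?B"
    using BMW_ge_1[OF assms(3)] by (simp add: BMW_def)
  have le: "BMW p X \<le> a * (2 * b)" if a: "a \<in> ?A" and b: "b \<in> ?B" for a b
  proof -
    obtain T where T: "b = ennreal T" "0 < T" "BMW_ineq p Y T"
      using b by blast
    show ?thesis
    proof (cases a)
      case (real D)
      then have D: "1 \<le> D" "Av2_ineq Y X (ennreal D)"
        using a by auto
      have "BMW p X \<le> ennreal (2 * D * T)"
        unfolding BMW_def
        using BMW_ineq_transfer[OF assms(1) D T(3)] D(1) T(2) by (intro Inf_lower) auto
      also have "\<dots> = a * (2 * b)"
        using D(1) T(2) by (simp add: real T(1) ennreal_mult mult_ac)
      finally show ?thesis .
    next
      case top
      then show ?thesis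
        using T by (simp add: ennreal_top_mult)
    qed
  qed
  \<comment> \<open>The infima are taken one after the other, first over \<open>D\<close> with the
    constant of \<open>Y\<close> fixed. If no constant exists for \<open>Y\<close>, the second
    infimum is \<open>\<infinity>\<close> and remains covered.\<close>
  have "BMW p X \<le> Inf ?A * (2 * b)" if "b \<in> ?B" for b
    using A that le[OF _ that] by (intro le_Inf_mult_ennreal) auto
  then have "BMW p X \<le> Inf ?B * (2 * Inf ?A)"
    using A B by (intro le_Inf_mult_ennreal) (auto simp: mult_ac)
  then show ?thesis
    by (simp add: BMW_def Av2_def mult_ac)
qed

end
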